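(* Let $p(x)=a_dx^d+\cdots+a_1x$ be a real polynomial of degree $d\ge2$ with $p(0)=0$, $p'(0)=\lambda>1$, whose Fatou component $\mathcal{F}_\infty$ containing $\infty$ contains an angular region $W_\beta=\{z\ne0:|\arg z|<\beta\}$ for some $\beta>0$, and let $\mathcal{J}_p$ denote its Julia set. Let $\Phi$ be the entire solution of $\Phi(\lambda z)=p(\Phi(z))$, $\Phi(0)=0$, $\Phi'(0)=1$, let $\rho=\log_\lambda d$, and let $F$ be the $1$-periodic holomorphic function on $\{|\Im w|<\beta/\log\lambda\}$ such that for all $\varepsilon>0$, $M>0$, $\Phi(z)=a_d^{-1/(d-1)}\exp\left(z^\rho F(\log_\lambda z)+o(|z|^{-M})\right)$ uniformly as $|z|\to\infty$ in $|\arg z|\le\beta-\varepsilon$. Assume that there is an angle $\gamma$ such that $\Phi(\{re^{i\gamma}: r>0\})$ intersects both $\mathcal{F}_\infty$ and $\mathcal{J}_p$. Then $F$ is not constant.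
   Context: $\log_\lambda z=\log z/\log\lambda$. Fatou and Julia sets are the standard notions of complex dynamics for the polynomial $p$. *)

theory Defs
  imports "HOL-Complex_Analysis.Complex_Analysis" "HOL-Computational_Algebra.Polynomial"
begin

text \<open>Normality of a sequence of holomorphic functions on an open set U, in the usual
sense allowing locally uniform divergence to infinity (i.e. normality w.r.t. the
spherical metric): every subsequence has a further subsequence that either converges
locally uniformly on U or tends to infinity locally uniformly on U.\<close>
definition normal_on :: "complex set \<Rightarrow> (nat \<Rightarrow> complex \<Rightarrow> complex) \<Rightarrow> bool" where
  "normal_on U fs \<longleftrightarrow>
     (\<forall>r::nat\<Rightarrow>nat. strict_mono r \<longrightarrow>
        (\<exists>s::nat\<Rightarrow>nat. strict_mono s \<and>
          ((\<exists>g. \<forall>K. compact K \<and> K \<subseteq> U \<longrightarrow>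
                 uniform_limit K (\<lambda>n. fs (r (s n))) g sequentially)
           \<or> (\<forall>K. compact K \<and> K \<subseteq> U \<longrightarrow>
                 (\<forall>B. eventually (\<lambda>n. \<forall>z\<in>K. B < norm (fs (r (s n)) z)) sequentially)))))"

definition fatou_set :: "complex poly \<Rightarrow> complex set" where
  "fatou_set p = {z. \<exists>U. open U \<and> z \<in> U \<and> normal_on U (\<lambda>n. (poly p) ^^ n)}"

definition julia_set :: "complex poly \<Rightarrow> complex set" where
  "julia_set p = - fatou_set p"

text \<open>The (finite part of the) Fatou component containing infinity: the connected
component of the Fatou set containing a punctured neighbourhood {|w| > R} of infinity.\<close>
definition fatou_inf :: "complex poly \<Rightarrow> complex set" where
  "fatou_inf p = {z. \<exists>R. {w. R < norm w} \<subseteq> connected_component_set (fatou_set p) z}"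

definition W_sector :: "real \<Rightarrow> complex set" where
  "W_sector \<beta> = {z. z \<noteq> 0 \<and> \<bar>Arg z\<bar> < \<beta>}"

end

theory Submission
  imports Defs "HOL-Real_Asymp.Real_Asymp"
    "HOL-Computational_Algebra.Fundamental_Theorem_Algebra"
begin

text \<open>Suppose \<open>F\<close> is a constant \<open>c\<close>. Since positive reals escape under \<open>p\<close>, \<open>Re c > 0\<close>. In the
  coordinate \<open>\<zeta> = c z\<^sup>\<rho>\<close>, which turns \<open>z \<mapsto> \<lambda> z\<close> into \<open>\<zeta> \<mapsto> d \<zeta>\<close>, the function \<open>\<Phi>\<close> is asymptotic to
  \<open>const * exp \<zeta>\<close>, so the \<open>p\<close>-orbits of its values at \<open>\<zeta>\<close> and \<open>\<zeta> + 2\<pi>i\<close> are asymptotic with ratio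
  tending to 1; as \<open>p\<close> expands such ratios near infinity, the two values agree. Hence \<open>\<Phi>\<close> is
  \<open>2\<pi>i\<close>-periodic in \<open>\<zeta>\<close> on the right half-plane, and comparing its behaviour at \<open>\<zeta> = 0\<close>, where it is
  like \<open>\<zeta>\<close> to the power \<open>1/\<rho>\<close>, with that at the regular point \<open>2\<pi>i\<close> shows that \<open>1/\<rho>\<close> is a natural
  number \<open>k\<close>. So \<open>\<Theta>(\<zeta>) = \<Phi>(c\<^bsup>-k\<^esup> \<zeta>\<^sup>k)\<close> is entire, \<open>2\<pi>i\<close>-periodic and satisfies
  \<open>\<Theta>(d \<zeta>) = p(\<Theta>(\<zeta>))\<close>. The closed set of \<open>\<zeta>\<close> for which \<open>\<Theta>(\<zeta>)\<close> has a bounded orbit is invariant under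
  multiplication by \<open>d\<close> and under all shifts \<open>2\<pi>i/d\<^sup>m\<close>, hence under all imaginary shifts; by the
  maximum principle on vertical strips it contains, with any point, the whole ray from 0 through that
  point. Thus no ray meets both the basin of infinity and the Julia set.\<close>

section \<open>Escape to infinity: Julia set and basin in terms of an escape radius\<close>

lemma poly_growth_radius:
  fixes p :: "complex poly"
  assumes "degree p \<ge> 2"
  obtains R where "R \<ge> 1" "\<And>x. norm x > R \<Longrightarrow> norm (poly p x) \<ge> 2 * norm x"
proof -
  obtain a b q where p: "p = pCons a (pCons b q)"
    by (metis pCons_cases)
  with assms have "q \<noteq> 0" by (auto split: if_splits)
  \<comment> \<open>The constant \<open>2 + norm a\<close> leaves room for the constant coefficient:
    \<open>(2 + norm a) * norm x - norm a\<close> is at least \<open>2 * norm x\<close> once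
    \<open>norm x\<close> is at least 1.\<close>
  then obtain r where r: "\<And>z. r \<le> norm z \<Longrightarrow> 2 + norm a \<le> norm (poly (pCons b q) z)"
    using poly_infinity by metis
  show thesis
  proof
    show "max 1 r \<ge> 1" by simp
    fix x :: complex assume x: "norm x > max 1 r"
    have "norm a * 1 \<le> norm a * norm x"
      using x by (intro mult_left_mono) auto
    moreover have "(2 + norm a) * norm x \<le> norm (poly (pCons b q) x) * norm x"
      using x r[of x] by (intro mult_right_mono) auto
    moreover have "norm (poly p x) \<ge> norm (x * poly (pCons b q) x) - norm a"
      unfolding p poly_pCons[of a] by (metis add.commute norm_diff_ineq)
    ultimately show "norm (poly p x) \<ge> 2 * norm x"
      unfolding norm_mult distrib_right mult.commute[of "norm x"] by linarith
  qed
qed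

text \<open>With such an \<open>R\<close>, an orbit is unbounded exactly when it leaves the disc of
  radius \<open>R\<close> once. This criterion stands in for the basin of infinity in everything
  that follows.\<close>

locale escape_radius =
  fixes p :: "complex poly" and R :: real
  assumes R_ge_1: "R \<ge> 1"
    and growth: "\<And>x. norm x > R \<Longrightarrow> norm (poly p x) \<ge> 2 * norm x"
begin

lemma iterate_growth: "norm x > R \<Longrightarrow> norm ((poly p ^^ n) x) \<ge> 2 ^ n * norm x"
proof (induction n)
  case (Suc n)
  have "1 * norm x \<le> 2 ^ n * norm x"
    by (intro mult_right_mono) auto
  with Suc have "norm ((poly p ^^ n) x) > R" by linarith
  from growth[OF this] Suc show ?case by simp
qed simp

lemma iterate_growth_from:
  assumes "norm ((poly p ^^ m) x) > R" "n \<ge> m"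
  shows "norm ((poly p ^^ n) x) \<ge> 2 ^ (n - m)" "norm ((poly p ^^ n) x) > R"
proof -
  have "(poly p ^^ n) x = (poly p ^^ (n - m)) ((poly p ^^ m) x)"
    using assms(2) by (metis comp_apply funpow_add le_add_diff_inverse2)
  then have *: "norm ((poly p ^^ n) x) \<ge> 2 ^ (n - m) * norm ((poly p ^^ m) x)"
    using iterate_growth[OF assms(1), of "n - m"] by simp
  have "2 ^ (n - m) * 1 \<le> 2 ^ (n - m) * norm ((poly p ^^ m) x)"
    using assms R_ge_1 by (intro mult_left_mono) auto
  with * show "norm ((poly p ^^ n) x) \<ge> 2 ^ (n - m)" by linarith
  have "1 * norm ((poly p ^^ m) x) \<le> 2 ^ (n - m) * norm ((poly p ^^ m) x)"
    by (intro mult_right_mono) auto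
  with * assms show "norm ((poly p ^^ n) x) > R" by linarith
qed

lemma continuous_iterate: "continuous_on UNIV ((poly p ^^ n) :: complex \<Rightarrow> complex)"
proof (induction n)
  case (Suc n)
  then show ?case
    by (auto simp: o_def intro!: continuous_intros)
qed (simp add: id_def)

text \<open>If some iterate of \<open>x\<close> left the disc, the same iterate would do so on a
  neighbourhood of \<open>x\<close>. All later iterates grow there at least like
  \<open>2 ^ (n - m)\<close>, so the family diverges locally uniformly and \<open>x\<close> would be
  a Fatou point.\<close>

lemma julia_set_bounded_orbit:
  assumes "x \<in> julia_set p"
  shows "norm ((poly p ^^ m) x) \<le> R"
proof (rule ccontr)
  assume m: "\<not> ?thesis"
  define U where "U = {y. R < norm ((poly p ^^ m) y)}"
  have "open U"
    unfolding U_def using continuous_iterate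
    by (intro open_Collect_less continuous_intros)
  moreover have "x \<in> U" using m by (simp add: U_def)
  moreover have "normal_on U (\<lambda>n. poly p ^^ n)"
    unfolding normal_on_def
  proof (intro allI impI)
    fix r :: "nat \<Rightarrow> nat" assume r: "strict_mono r"
    have "\<forall>\<^sub>F n in sequentially. \<forall>z\<in>K. B < norm ((poly p ^^ r (id n)) z)"
      if "K \<subseteq> U" for K and B :: real
    proof -
      obtain j where j: "B < 2 ^ j"
        using real_arch_pow[of 2 B] by auto
      have "\<forall>\<^sub>F n in sequentially. n \<ge> m + j"
        by (rule eventually_ge_at_top)
      then show ?thesis
      proof eventually_elim
        case (elim n)
        then have n: "r n \<ge> m + j"
          using strict_mono_imp_increasing[OF r, of n] by linarith
        show ?case
        proof
          fix z assume "z \<in> K"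
          then have "norm ((poly p ^^ r n) z) \<ge> 2 ^ (r n - m)"
            using that n iterate_growth_from(1)[of m z "r n"] by (auto simp: U_def)
          moreover have "(2::real) ^ j \<le> 2 ^ (r n - m)"
            using n by (intro power_increasing) auto
          ultimately show "B < norm ((poly p ^^ r (id n)) z)"
            using j unfolding id_apply by linarith
        qed
      qed
    qed
    then show "\<exists>s. strict_mono s \<and>
          ((\<exists>g. \<forall>K. compact K \<and> K \<subseteq> U \<longrightarrow> uniform_limit K (\<lambda>n. poly p ^^ r (s n)) g sequentially)
           \<or> (\<forall>K. compact K \<and> K \<subseteq> U \<longrightarrow>
                 (\<forall>B. \<forall>\<^sub>F n in sequentially. \<forall>z\<in>K. B < norm ((poly p ^^ r (s n)) z))))"
      by (intro exI[of _ id]) (auto simp: strict_mono_def)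
  qed
  ultimately show False
    using assms by (auto simp: julia_set_def fatou_set_def)
qed

text \<open>The escaping points form an open set \<open>E\<close> with no Fatou point on its
  boundary. By connectedness a Fatou component lies in \<open>E\<close> or in the interior of the
  complement, and the unbounded one meets \<open>E\<close>.\<close>

lemma fatou_inf_escapes:
  assumes "x \<in> fatou_inf p"
  shows "\<exists>n. norm ((poly p ^^ n) x) > R"
proof -
  define E where "E = {y. \<exists>n. norm ((poly p ^^ n) y) > R}"
  define C where "C = connected_component_set (fatou_set p) x"
  obtain r where r: "{w. r < norm w} \<subseteq> C"
    using assms by (auto simp: fatou_inf_def C_def)
  have "open {y. R < norm ((poly p ^^ n) y)}" for n
    using continuous_iterate by (intro open_Collect_less continuous_intros)
  moreover have "E = (\<Union>n. {y. R < norm ((poly p ^^ n) y)})" by (auto simp: E_def)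
  ultimately have "open E" by auto
  have sub: "C \<subseteq> E \<union> interior (- E)"
  proof
    fix y assume "y \<in> C"
    then have "y \<in> fatou_set p"
      using connected_component_subset unfolding C_def by blast
    then obtain U where U: "open U" "y \<in> U" "normal_on U (\<lambda>n. poly p ^^ n)"
      by (auto simp: fatou_set_def)
    show "y \<in> E \<union> interior (- E)"
    proof (rule ccontr)
      \<comment> \<open>Here \<open>y\<close> does not escape although every neighbourhood contains
        escaping points \<open>v\<close>. Testing the two alternatives of normality on the compact
        sets \<open>{v}\<close> and \<open>{y}\<close> refutes both.\<close>
      assume y: "y \<notin> E \<union> interior (- E)"
      then obtain v where v: "v \<in> U" "v \<in> E"
        using U by (meson ComplI UnCI interiorI subsetI)
      obtain s :: "nat \<Rightarrow> nat" where s: "strict_mono s" and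
        alt: "(\<exists>g. \<forall>K. compact K \<and> K \<subseteq> U \<longrightarrow> uniform_limit K (\<lambda>n. poly p ^^ s n) g sequentially)
           \<or> (\<forall>K. compact K \<and> K \<subseteq> U \<longrightarrow>
                 (\<forall>B. \<forall>\<^sub>F n in sequentially. \<forall>z\<in>K. B < norm ((poly p ^^ s n) z)))"
        using U(3)[unfolded normal_on_def, rule_format, OF strict_mono_id]
        unfolding id_apply by blast
      from alt show False
      proof
        assume "\<exists>g. \<forall>K. compact K \<and> K \<subseteq> U \<longrightarrow> uniform_limit K (\<lambda>n. poly p ^^ s n) g sequentially"
        then obtain g where "uniform_limit {v} (\<lambda>n. poly p ^^ s n) g sequentially"
          using v by (metis compact_sing empty_subsetI insert_subset)
        then have "(\<lambda>n. (poly p ^^ s n) v) \<longlonglongrightarrow> g v"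
          by (rule tendsto_uniform_limitI) simp
        then have "Bseq (\<lambda>n. (poly p ^^ s n) v)"
          by (meson convergentI convergent_imp_Bseq)
        then obtain B where B: "\<And>n. norm ((poly p ^^ s n) v) \<le> B"
          by (auto simp: Bseq_def)
        obtain m where m: "norm ((poly p ^^ m) v) > R" using v by (auto simp: E_def)
        obtain j where j: "B < 2 ^ j" using real_arch_pow[of 2 B] by auto
        have sj: "s (m + j) \<ge> m + j" using s by (rule strict_mono_imp_increasing)
        have "(2::real) ^ j \<le> 2 ^ (s (m + j) - m)"
          using sj by (intro power_increasing) auto
        also have "\<dots> \<le> norm ((poly p ^^ s (m + j)) v)"
          using m sj by (intro iterate_growth_from(1)) auto
        also have "\<dots> \<le> B" by (rule B)
        finally show False using j by simp
      next
        assume "\<forall>K. compact K \<and> K \<subseteq> U \<longrightarrow>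
                 (\<forall>B. \<forall>\<^sub>F n in sequentially. \<forall>z\<in>K. B < norm ((poly p ^^ s n) z))"
        from this[rule_format, of "{y}" R] U(2)
        have "\<forall>\<^sub>F n in sequentially. \<forall>z\<in>{y}. R < norm ((poly p ^^ s n) z)"
          by simp
        then have "y \<in> E"
          by (auto simp: E_def dest: eventually_happens'[OF sequentially_bot])
        then show False using y by simp
      qed
    qed
  qed
  define w :: complex where "w = of_real (max R r + 1)"
  have nw: "norm w > R" "norm w > r" 
    unfolding w_def norm_of_real using R_ge_1 by linarith+
  then have "w \<in> E" by (auto simp: E_def intro: exI[of _ 0])
  moreover have "w \<in> C" using r nw by auto
  moreover have "connected C" by (simp add: C_def)
  moreover have "E \<inter> interior (- E) \<inter> C = {}"
    using interior_subset by blast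
  ultimately have "interior (- E) \<inter> C = {}"
    using connectedD[OF _ \<open>open E\<close> open_interior, of C "- E"] sub by blast
  \<comment> \<open>A component set is empty unless its base point lies in the underlying set, so
    one far away point in \<open>C\<close> already puts \<open>x\<close> in
    \<open>C\<close>.\<close>
  moreover have "x \<in> C"
    using r nw(2) unfolding C_def
    by (metis (mono_tags) connected_component_eq_empty connected_component_refl_eq empty_iff mem_Collect_eq subsetD)
  ultimately show ?thesis using sub by (auto simp: E_def)
qed

end

section \<open>Expansion of ratios near infinity\<close>

text \<open>Writing \<open>u = 1 / y\<close> and \<open>v = x / y\<close>, the quotient \<open>p(x) / p(y)\<close> becomes a quotient of
  polynomials in \<open>(u, v)\<close> that is regular at \<open>(0, 1)\<close> and equals \<open>v\<^sup>d\<close> for \<open>u = 0\<close>.\<close>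
lemma poly_quotient_expanding_near_infinity:
  fixes p :: "complex poly"
  assumes deg: "degree p \<ge> 2"
  obtains r where "r > 0"
    "\<And>x y. \<lbrakk>1 / r < norm y; norm (x / y - 1) < r\<rbrakk> \<Longrightarrow>
       poly p y \<noteq> 0 \<and> norm (x / y - 1) \<le> norm (poly p x / poly p y - 1)"
proof -
  define d where "d = degree p"
  define H where "H u v = (\<Sum>i\<le>d. coeff p i * u ^ (d - i) * v ^ i)" for u v :: complex
  \<comment> \<open>\<open>D\<close> is the difference quotient of \<open>H\<close> in
    \<open>v\<close> at 1. At \<open>(0, 1)\<close> it is \<open>d\<close> times the value of
    \<open>H\<close>; since \<open>d\<close> exceeds 1, \<open>D\<close> still dominates
    \<open>H u 1\<close> nearby, which is the source of the expansion.\<close>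
  define D where "D u v = (\<Sum>i\<le>d. coeff p i * u ^ (d - i) * (\<Sum>j<i. v ^ j))" for u v :: complex
  have a: "coeff p d \<noteq> 0" using deg by (auto simp: d_def)
  have zero: "(\<Sum>i\<le>d. coeff p i * 0 ^ (d - i) * f i) = coeff p d * f d" for f :: "nat \<Rightarrow> complex"
  proof -
    have "(\<Sum>i\<le>d. coeff p i * 0 ^ (d - i) * f i) = (\<Sum>i\<le>d. if i = d then coeff p d * f d else 0)"
      by (intro sum.cong) (auto simp: power_0_left)
    then show ?thesis by simp
  qed
  have H1: "H 0 1 = coeff p d" and D1: "D 0 1 = coeff p d * of_nat d"
    unfolding H_def D_def zero by simp_all
  have "((\<lambda>z. norm (D (fst z) (snd z)) - norm (H (fst z) 1)) \<longlongrightarrow> norm (D 0 1) - norm (H 0 1)) (nhds (0, 1))"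
    unfolding H_def D_def by (auto intro!: tendsto_eq_intros filterlim_ident)
  moreover have "norm (D 0 1) - norm (H 0 1) > 0"
    using a deg unfolding H1 D1 d_def[symmetric] by (simp add: norm_mult)
  ultimately have "\<forall>\<^sub>F z in nhds (0, 1). norm (D (fst z) (snd z)) - norm (H (fst z) 1) > 0"
    by (rule order_tendstoD)
  moreover have "((\<lambda>z::complex \<times> complex. H (fst z) 1) \<longlongrightarrow> H 0 1) (nhds (0, 1))"
    unfolding H_def by (auto intro!: tendsto_eq_intros filterlim_ident)
  then have "\<forall>\<^sub>F z in nhds (0, 1::complex). H (fst z) 1 \<noteq> 0"
    by (rule tendsto_imp_eventually_ne) (use a H1 in simp)
  ultimately have "\<forall>\<^sub>F z in nhds (0, 1). norm (H (fst z) 1) \<le> norm (D (fst z) (snd z)) \<and> H (fst z) 1 \<noteq> 0"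
    by eventually_elim auto
  then obtain e where e: "e > 0"
    "\<And>u v. dist (u, v) (0, 1) < e \<Longrightarrow> norm (H u 1) \<le> norm (D u v) \<and> H u 1 \<noteq> 0"
    unfolding eventually_nhds_metric by auto
  have poly_H: "poly p x = y ^ d * H (1 / y) (x / y)" if "y \<noteq> 0" for x y
    unfolding poly_altdef H_def d_def[symmetric] sum_distrib_left
  proof (rule sum.cong)
    fix i assume "i \<in> {..d}"
    then have "y ^ d = y ^ (d - i) * y ^ i" by (simp flip: power_add)
    then show "coeff p i * x ^ i = y ^ d * (coeff p i * (1 / y) ^ (d - i) * (x / y) ^ i)"
      using that by (simp add: field_simps power_divide)
  qed simp
  have H_diff: "H u v - H u 1 = (v - 1) * D u v" for u v
  proof -
    have "coeff p i * u ^ (d - i) * v ^ i - coeff p i * u ^ (d - i) * 1 ^ i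
        = (v - 1) * (coeff p i * u ^ (d - i) * (\<Sum>j<i. v ^ j))" for i
      unfolding mult.left_commute[of "v - 1"] power_diff_1_eq[symmetric]
      by (simp add: right_diff_distrib)
    then have "H u v - H u 1 = (\<Sum>i\<le>d. (v - 1) * (coeff p i * u ^ (d - i) * (\<Sum>j<i. v ^ j)))"
      unfolding H_def by (simp flip: sum_subtractf)
    then show ?thesis unfolding D_def by (subst sum_distrib_left)
  qed
  show thesis
  proof
    show "e / 2 > 0" using e by simp
    fix x y :: complex
    assume y: "1 / (e / 2) < norm y" and xy: "norm (x / y - 1) < e / 2"
    have "y \<noteq> 0" using y e by auto
    define u v where "u = 1 / y" and "v = x / y"
    have "norm u < e / 2"
      using y e \<open>y \<noteq> 0\<close> by (simp add: u_def norm_divide field_simps)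
    then have "dist (u, v) (0, 1) < e"
      using xy sqrt_sum_squares_le_sum_abs[of "norm u" "norm (v - 1)"]
      unfolding dist_Pair_Pair by (simp add: dist_norm v_def)
    then have uv: "norm (H u 1) \<le> norm (D u v)" "H u 1 \<noteq> 0" using e by auto
    have py: "poly p y = y ^ d * H u 1" and px: "poly p x = y ^ d * H u v"
      using poly_H[OF \<open>y \<noteq> 0\<close>] \<open>y \<noteq> 0\<close> by (simp_all add: u_def v_def)
    have "poly p x / poly p y - 1 = (H u v - H u 1) / H u 1"
      unfolding px py using uv \<open>y \<noteq> 0\<close> by (simp add: field_simps)
    also have "\<dots> = (v - 1) * (D u v / H u 1)" by (simp add: H_diff)
    finally have "norm (poly p x / poly p y - 1) = norm (v - 1) * norm (D u v / H u 1)"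
      by (simp only: norm_mult)
    moreover have "norm (v - 1) * 1 \<le> norm (v - 1) * norm (D u v / H u 1)"
      using uv by (intro mult_left_mono) (auto simp: norm_divide field_simps)
    ultimately show "poly p y \<noteq> 0 \<and> norm (x / y - 1) \<le> norm (poly p x / poly p y - 1)"
      using uv \<open>y \<noteq> 0\<close> by (auto simp: py v_def)
  qed
qed

text \<open>By the expansion near infinity the distance of \<open>x n / y n\<close> from 1 cannot
  decrease with \<open>n\<close>, yet it tends to 0; so it is 0 from the start. The discrepancy sits
  in an exponent because the asymptotic formula for \<open>\<Phi>\<close> delivers it there.\<close>

lemma orbits_eq_if_asymptotic:
  fixes p :: "complex poly"
  assumes "degree p \<ge> 2"
  obtains r where "r > 0"
    "\<And>x y \<eta>. \<lbrakk>\<And>n. x (Suc n) = poly p (x n); \<And>n. y (Suc n) = poly p (y n);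
       \<And>n. norm (y n) > 1 / r; \<And>n. x n = y n * exp (\<eta> n); \<And>n. norm (\<eta> n) < r; \<eta> \<longlonglongrightarrow> 0\<rbrakk>
       \<Longrightarrow> x 0 = y (0::nat)"
proof -
  obtain r where r: "r > 0"
    "\<And>x y. \<lbrakk>1 / r < norm y; norm (x / y - 1) < r\<rbrakk> \<Longrightarrow>
       poly p y \<noteq> 0 \<and> norm (x / y - 1) \<le> norm (poly p x / poly p y - 1)"
    using poly_quotient_expanding_near_infinity[OF assms] by blast
  have "isCont (exp :: complex \<Rightarrow> complex) 0" by simp
  then obtain s where s: "s > 0" "\<And>z::complex. norm z < s \<Longrightarrow> norm (exp z - 1) < r"
    using r(1) unfolding continuous_at_eps_delta dist_norm by fastforce
  show thesis
  proof
    show "min r s > 0" using r s by simp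
    fix x y \<eta> :: "nat \<Rightarrow> complex"
    assume x: "\<And>n. x (Suc n) = poly p (x n)" and y: "\<And>n. y (Suc n) = poly p (y n)"
      and yr: "\<And>n. norm (y n) > 1 / min r s" and xy: "\<And>n. x n = y n * exp (\<eta> n)"
      and \<eta>: "\<And>n. norm (\<eta> n) < min r s" and lim: "\<eta> \<longlonglongrightarrow> 0"
    have "1 / r \<le> 1 / min r s" using r s by (intro divide_left_mono) auto
    then have yr': "1 / r < norm (y n)" for n using yr[of n] by linarith
    have "1 / r > 0" using r by simp
    then have y0: "y n \<noteq> 0" for n using yr'[of n] by auto
    have q: "x n / y n = exp (\<eta> n)" for n using y0 by (simp add: xy)
    have "norm (x 0 / y 0 - 1) \<le> norm (x n / y n - 1)" for n
    proof (induction n)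
      case (Suc n)
      have "norm (x n / y n - 1) \<le> norm (x (Suc n) / y (Suc n) - 1)"
        unfolding x y using r(2)[OF yr', of "x n" n] s(2)[of "\<eta> n"] \<eta>[of n] by (simp add: q)
      with Suc show ?case by linarith
    qed simp
    moreover have "(\<lambda>n. norm (x n / y n - 1)) \<longlonglongrightarrow> 0"
      unfolding q by (auto intro!: tendsto_eq_intros lim)
    ultimately have "norm (x 0 / y 0 - 1) \<le> 0"
      by (meson LIMSEQ_le_const)
    then show "x 0 = y 0" using y0[of 0] by simp
  qed
qed

section \<open>Two facts on holomorphic functions: periodic strips and power asymptotics\<close>

text \<open>Periodicity along the strip lets \<open>norm (f z)\<close> attain its maximum over the
  strip in one compact rectangle. An interior maximum makes \<open>f\<close> constant, and then the
  line \<open>Re z = 0\<close> controls its value.\<close>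

lemma periodic_bounded_in_strip:
  fixes f :: "complex \<Rightarrow> complex"
  assumes hol: "f holomorphic_on UNIV" and per: "\<And>z. f (z + \<i> * of_real P) = f z" "P > 0"
    and bd: "\<And>z. Re z = 0 \<Longrightarrow> norm (f z) \<le> B" "\<And>z. Re z = 1 \<Longrightarrow> norm (f z) \<le> B"
    and z: "0 \<le> Re z" "Re z \<le> 1"
  shows "norm (f z) \<le> B"
proof -
  have per_nat: "f (w + of_nat n * (\<i> * of_real P)) = f w" for w n
  proof (induction n)
    case (Suc n)
    then show ?case
      using per(1)[of "w + of_nat n * (\<i> * of_real P)"] by (simp add: algebra_simps)
  qed simp
  have per_int: "f (w + of_int n * (\<i> * of_real P)) = f w" for w n
  proof (cases n rule: int_cases2)
    case (nonneg m)
    then show ?thesis using per_nat[of w m] by simp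
  next
    case (nonpos m)
    then show ?thesis using per_nat[of "w - of_nat m * (\<i> * of_real P)" m] by simp
  qed
  define Q where "Q = cbox 0 (Complex 1 P)"
  have "0 \<in> Q" using \<open>P > 0\<close> by (auto simp: Q_def in_cbox_complex_iff)
  moreover have "continuous_on Q (\<lambda>z. norm (f z))"
    using hol holomorphic_on_imp_continuous_on holomorphic_on_subset
    by (intro continuous_intros) blast
  ultimately obtain \<xi> where \<xi>: "\<xi> \<in> Q" "\<And>w. w \<in> Q \<Longrightarrow> norm (f w) \<le> norm (f \<xi>)"
    using continuous_attains_sup[of Q "\<lambda>z. norm (f z)"] by (auto simp: Q_def)
  have max: "norm (f w) \<le> norm (f \<xi>)" if "0 \<le> Re w" "Re w \<le> 1" for w
  proof -
    define n where "n = \<lfloor>Im w / P\<rfloor>"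
    define w' where "w' = w + of_int (- n) * (\<i> * of_real P)"
    have "of_int n \<le> Im w / P" "Im w / P \<le> of_int n + 1"
      unfolding n_def by linarith+
    then have "of_int n * P \<le> Im w" "Im w \<le> (of_int n + 1) * P"
      using \<open>P > 0\<close> by (simp_all add: pos_le_divide_eq pos_divide_le_eq)
    then have "w' \<in> Q"
      using that by (simp add: Q_def w'_def in_cbox_complex_iff algebra_simps)
    then show ?thesis using \<xi>(2)[of w'] per_int[of w "- n"] by (simp add: w'_def)
  qed
  have "norm (f \<xi>) \<le> B"
  proof (cases "0 < Re \<xi> \<and> Re \<xi> < 1")
    case True
    have "open {w. 0 < Re w \<and> Re w < 1}"
      by (intro open_Collect_conj open_Collect_less continuous_intros)
    then have "f constant_on UNIV"
      using True max by (intro maximum_modulus_principle[OF hol, of "{w. 0 < Re w \<and> Re w < 1}" \<xi>]) auto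
    then have "f \<xi> = f 0" by (auto simp: constant_on_def)
    then show ?thesis using bd(1)[of 0] by simp
  next
    case False
    with \<xi>(1) have "Re \<xi> = 0 \<or> Re \<xi> = 1" by (auto simp: Q_def in_cbox_complex_iff)
    then show ?thesis using bd by auto
  qed
  with max[OF z] show ?thesis by linarith
qed

text \<open>Near 0 the function is \<open>w ^ n\<close> times a nonvanishing factor for an integer
  order \<open>n\<close>. On the positive reals its modulus is comparable to
  \<open>s powr \<kappa>\<close> only if the two exponents agree.\<close>

lemma holomorphic_asymptotic_powr_imp_nat:
  fixes g :: "complex \<Rightarrow> complex"
  assumes hol: "g holomorphic_on ball 0 r" and "r > 0" "\<kappa> > 0"
    and lim: "((\<lambda>s. g (of_real s) / of_real (s powr \<kappa>)) \<longlongrightarrow> L) (at_right 0)" and "L \<noteq> 0"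
  obtains k :: nat where "k > 0" "\<kappa> = real k"
proof -
  have small: "\<forall>\<^sub>F s in at_right 0. 0 < s \<and> s < e" if "e > 0" for e :: real
    using eventually_at_right_real[OF that] by (auto elim: eventually_mono)
  have of_real: "((\<lambda>s. complex_of_real s) \<longlongrightarrow> 0) (at_right 0)"
    by (auto intro!: tendsto_eq_intros)
  have pw: "((\<lambda>s::real. s powr a) \<longlongrightarrow> 0) (at_right 0)" if "a > 0" for a
    using that by real_asymp
  have "((\<lambda>s. g (of_real s) / of_real (s powr \<kappa>) * of_real (s powr \<kappa>)) \<longlongrightarrow> L * of_real 0) (at_right 0)"
    by (intro tendsto_intros lim pw assms)
  moreover have "\<forall>\<^sub>F s in at_right 0. g (of_real s) / of_real (s powr \<kappa>) * of_real (s powr \<kappa>) = g (of_real s)"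
    using small[OF zero_less_one] by eventually_elim auto
  ultimately have "((\<lambda>s. g (of_real s)) \<longlongrightarrow> 0) (at_right 0)"
    by (simp add: tendsto_cong)
  moreover have "isCont g 0"
    using continuous_on_interior[OF holomorphic_on_imp_continuous_on[OF hol]] \<open>r > 0\<close>
    by (simp add: interior_open)
  then have "((\<lambda>s. g (of_real s)) \<longlongrightarrow> g 0) (at_right 0)"
    using of_real by (rule isCont_tendsto_compose)
  ultimately have g0: "g 0 = 0"
    using tendsto_unique trivial_limit_at_right_real by blast
  \<comment> \<open>The zero at 0 has finite order, since an identically vanishing \<open>g\<close>
    would give \<open>L = 0\<close>.\<close>
  have nonconst: "\<not> g constant_on ball 0 r"
  proof
    assume "g constant_on ball 0 r"
    then have z: "g w = 0" if "norm w < r" for w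
      using g0 that \<open>r > 0\<close> unfolding constant_on_def by (metis centre_in_ball mem_ball_0)
    have "\<forall>\<^sub>F s in at_right 0. g (of_real s) / of_real (s powr \<kappa>) = 0"
      using small[OF \<open>r > 0\<close>] by eventually_elim (simp add: z)
    then have "((\<lambda>s. g (of_real s) / of_real (s powr \<kappa>)) \<longlongrightarrow> 0) (at_right 0)"
      by (rule tendsto_eventually)
    with lim have "L = 0" by (rule tendsto_unique[rotated]) simp
    with \<open>L \<noteq> 0\<close> show False by simp
  qed
  have "0 \<in> ball (0::complex) r" using \<open>r > 0\<close> by simp
  then obtain h e n where h: "n > 0" "e > 0" "h holomorphic_on ball 0 e"
    "\<And>w. w \<in> ball 0 e \<Longrightarrow> g w = (w - 0) ^ n * h w" "\<And>w. w \<in> ball 0 e \<Longrightarrow> h w \<noteq> 0"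
    by (rule holomorphic_factor_zero_nonconstant[OF hol open_ball connected_ball _ g0 nonconst])
       (rule that)
  have "isCont h 0"
    using continuous_on_interior[OF holomorphic_on_imp_continuous_on[OF h(3)]] \<open>e > 0\<close>
    by (simp add: interior_open)
  then have lim_h: "((\<lambda>s. h (of_real s)) \<longlongrightarrow> h 0) (at_right 0)"
    using of_real by (rule isCont_tendsto_compose)
  have h0: "h 0 \<noteq> 0" using h by simp
  \<comment> \<open>The moduli reduce to the pure power \<open>s powr (real n - \<kappa>)\<close>,
    which has a finite nonzero limit at 0 only for exponent 0.\<close>
  have "((\<lambda>s. norm (g (of_real s) / of_real (s powr \<kappa>) / h (of_real s))) \<longlongrightarrow> norm (L / h 0)) (at_right 0)"
    by (intro tendsto_intros lim lim_h h0)
  moreover have "\<forall>\<^sub>F s in at_right 0.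
      norm (g (of_real s) / of_real (s powr \<kappa>) / h (of_real s)) = s powr (real n - \<kappa>)"
    using small[OF \<open>e > 0\<close>]
  proof eventually_elim
    case (elim s)
    then have "g (of_real s) = of_real s ^ n * h (of_real s)" "h (of_real s) \<noteq> 0"
      using h(4,5)[of "of_real s"] by auto
    then show ?case
      using elim by (simp add: norm_divide norm_mult norm_power powr_diff powr_realpow)
  qed
  ultimately have lim': "((\<lambda>s. s powr (real n - \<kappa>)) \<longlongrightarrow> norm (L / h 0)) (at_right 0)"
    by (simp add: tendsto_cong)
  have pos: "norm (L / h 0) > 0" using \<open>L \<noteq> 0\<close> h0 by simp
  have "\<not> real n > \<kappa>"
    using tendsto_unique[OF _ lim' pw[of "real n - \<kappa>"]] pos by auto
  moreover have "\<not> real n < \<kappa>"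
  proof
    assume "real n < \<kappa>"
    then have "filterlim (\<lambda>s::real. s powr (real n - \<kappa>)) at_top (at_right 0)"
      by real_asymp
    then show False
      using lim' not_tendsto_and_filterlim_at_infinity[of "at_right (0::real)"]
      by (meson filterlim_at_top_imp_at_infinity trivial_limit_at_right_real)
  qed
  ultimately have "\<kappa> = real n" by simp
  with that h show thesis by blast
qed

section \<open>Bounded orbits along rays for a periodic semiconjugacy\<close>

text \<open>All bounds use the one constant \<open>R\<close>: on vertical lines in \<open>A\<close>
  the modulus of \<open>\<Theta>\<close> is at most \<open>R\<close>, and the maximum principle
  passes this unchanged to the strip between the imaginary axis and such a line. The segment from 0
  to a point of \<open>A\<close> stays in that strip.\<close>

lemma (in escape_radius) periodic_semiconj_bounded_along_ray:
  fixes \<Theta> :: "complex \<Rightarrow> complex" and d :: nat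
  assumes hol: "\<Theta> holomorphic_on UNIV" and d: "d \<ge> 2"
    and semi: "\<And>z. \<Theta> (of_nat d * z) = poly p (\<Theta> z)"
    and per: "\<And>z. \<Theta> (z + 2 * of_real pi * \<i>) = \<Theta> z"
    and zero: "norm (\<Theta> 0) \<le> R"
    and w: "\<And>n. norm ((poly p ^^ n) (\<Theta> w)) \<le> R" and t: "t > 0"
  shows "norm ((poly p ^^ n) (\<Theta> (of_real t * w))) \<le> R"
proof -
  have iter: "(poly p ^^ n) (\<Theta> z) = \<Theta> (of_nat d ^ n * z)" for n z
  proof (induction n)
    case (Suc n)
    then show ?case by (simp add: mult.assoc flip: semi)
  qed simp
  define A where "A = {z. \<forall>n. norm (\<Theta> (of_nat d ^ n * z)) \<le> R}"
  have cont: "continuous_on UNIV \<Theta>"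
    using hol by (rule holomorphic_on_imp_continuous_on)
  have "closed {z. norm (\<Theta> (of_nat d ^ n * z)) \<le> R}" for n
    by (intro closed_Collect_le continuous_intros continuous_on_compose2[OF cont]) auto
  moreover have "A = (\<Inter>n. {z. norm (\<Theta> (of_nat d ^ n * z)) \<le> R})" by (auto simp: A_def)
  ultimately have "closed A" by auto
  \<comment> \<open>An orbit outside the disc never returns, so a bound at all late times already
    gives membership in \<open>A\<close>.\<close>
  have tail: "z \<in> A" if "\<And>n. n \<ge> m \<Longrightarrow> norm (\<Theta> (of_nat d ^ n * z)) \<le> R" for m z
    unfolding A_def
  proof (clarify, rule ccontr)
    fix n assume "\<not> norm (\<Theta> (of_nat d ^ n * z)) \<le> R"
    then have "norm ((poly p ^^ n) (\<Theta> z)) > R" by (simp add: iter)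
    then have "norm ((poly p ^^ max m n) (\<Theta> z)) > R" by (rule iterate_growth_from) simp
    with that[of "max m n"] show False by (simp add: iter)
  qed
  have A_D: "norm (\<Theta> z) \<le> R" if "z \<in> A" for z
    using that by (auto simp: A_def dest: spec[of _ 0])
  have scale: "of_nat d ^ m * z \<in> A" if "z \<in> A" for m z
    using that by (simp add: A_def flip: mult.assoc power_add)
  have "0 \<in> A" using zero by (simp add: A_def)
  have per_nat: "\<Theta> (z + of_nat j * (2 * of_real pi * \<i>)) = \<Theta> z" for z j
  proof (induction j)
    case (Suc j)
    then show ?case
      using per[of "z + of_nat j * (2 * of_real pi * \<i>)"] by (simp add: algebra_simps)
  qed simp
  have per_int: "\<Theta> (z + of_int j * (2 * of_real pi * \<i>)) = \<Theta> z" for z j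
  proof (cases j rule: int_cases2)
    case (nonneg m)
    then show ?thesis using per_nat[of z m] by simp
  next
    case (nonpos m)
    then show ?thesis using per_nat[of "z - of_nat m * (2 * of_real pi * \<i>)" m] by simp
  qed
  \<comment> \<open>From time \<open>m\<close> on, multiplication by \<open>d ^ n\<close> turns the
    shift into an integer multiple of the period.\<close>
  have shift: "z + of_int j * (2 * of_real pi * \<i>) / of_nat d ^ m \<in> A" if "z \<in> A" for z j m
  proof (rule tail[of m])
    fix n assume "n \<ge> m"
    then have "of_nat d ^ n = (of_nat d ^ (n - m) * of_nat d ^ m :: complex)"
      by (simp flip: power_add)
    then have "of_nat d ^ n * (z + of_int j * (2 * of_real pi * \<i>) / of_nat d ^ m)
        = of_nat d ^ n * z + of_int (int d ^ (n - m) * j) * (2 * of_real pi * \<i>)"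
      using d by (simp add: field_simps)
    then show "norm (\<Theta> (of_nat d ^ n * (z + of_int j * (2 * of_real pi * \<i>) / of_nat d ^ m))) \<le> R"
      using that unfolding A_def by (simp only: per_int) simp
  qed
  \<comment> \<open>The shifts by multiples of \<open>2 * pi / d ^ m\<close> become dense in the
    imaginary direction as \<open>m\<close> grows, and \<open>A\<close> is closed. Rounding
    \<open>q\<close> down picks a shift with error at most \<open>2 * pi / d ^ m\<close>.\<close>
  have vertical: "z' \<in> A" if "z \<in> A" "Re z' = Re z" for z z'
  proof -
    have "\<exists>y\<in>A. dist y z' < e" if "e > 0" for e
    proof -
      obtain m where m: "2 * pi / e < real d ^ m"
        using real_arch_pow[of "real d" "2 * pi / e"] d by auto
      have dm: "real d ^ m > 0" using d by simp
      define q where "q = (Im z' - Im z) * real d ^ m / (2 * pi)"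
      have q: "(Im z' - Im z) = q * (2 * pi / real d ^ m)"
        using d by (simp add: q_def)
      define y where "y = z + of_int \<lfloor>q\<rfloor> * (2 * of_real pi * \<i>) / of_nat d ^ m"
      have "of_nat d ^ m = complex_of_real (real d ^ m)" by simp
      then have y: "y = z + \<i> * of_real (of_int \<lfloor>q\<rfloor> * (2 * pi / real d ^ m))"
        by (simp add: y_def)
      have "y - z' = \<i> * of_real ((of_int \<lfloor>q\<rfloor> - q) * (2 * pi / real d ^ m))"
        using q \<open>Re z' = Re z\<close> by (simp add: y complex_eq_iff algebra_simps diff_divide_distrib)
      then have "dist y z' = \<bar>of_int \<lfloor>q\<rfloor> - q\<bar> * (2 * pi / real d ^ m)"
        by (simp add: dist_norm norm_mult abs_mult del: of_real_mult of_real_divide)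
      also have "\<dots> \<le> 1 * (2 * pi / real d ^ m)"
        using d by (intro mult_right_mono) (linarith, simp)
      also have "\<dots> < e" using m dm \<open>e > 0\<close> by (simp add: field_simps)
      finally show ?thesis using shift[OF \<open>z \<in> A\<close>] by (auto simp: y_def)
    qed
    then show ?thesis using closed_approachable[OF \<open>closed A\<close>] by blast
  qed
  have strip: "z' \<in> A" if z: "z \<in> A" "Re z' = \<tau> * Re z" "0 \<le> \<tau>" "\<tau> \<le> 1" for z z' \<tau>
  proof (cases "Re z = 0")
    case True
    then show ?thesis using vertical[OF \<open>0 \<in> A\<close>] z by simp
  next
    case False
    have "norm (\<Theta> (of_nat d ^ n * z')) \<le> R" for n
    proof -
      \<comment> \<open>For each time \<open>n\<close> separately, the strip between the imaginary
        axis and the line through \<open>d ^ n * z\<close> is rescaled to real parts in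
        \<open>[0, 1]\<close>. Dividing by the signed \<open>X\<close> treats both half-planes at
        once, and the period becomes \<open>2 * pi / \<bar>X\<bar>\<close>.\<close>
      define X where "X = real d ^ n * Re z"
      define P where "P = 2 * pi / \<bar>X\<bar>"
      have "X \<noteq> 0" using False d by (simp add: X_def)
      then have P: "P > 0" by (simp add: P_def)
      have X: "of_real X = (of_nat d ^ n * of_real (Re z) :: complex)" by (simp add: X_def)
      define f where "f w = \<Theta> (of_real X * w)" for w
      have "norm (f (z' / of_real (Re z))) \<le> R"
      proof (rule periodic_bounded_in_strip[of f, OF _ _ P])
        show "f holomorphic_on UNIV"
          unfolding f_def
          by (intro holomorphic_on_compose_gen[OF _ hol, unfolded o_def] holomorphic_intros) auto
        fix w
        have "of_real X * (w + \<i> * of_real P) = of_real X * w + of_real (X * P) * \<i>"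
          by (simp add: algebra_simps)
        also have "X * P = of_int (if X > 0 then 1 else -1) * (2 * pi)"
          using \<open>X \<noteq> 0\<close> by (simp add: P_def)
        finally show "f (w + \<i> * of_real P) = f w"
          using per_int[of "of_real X * w" "if X > 0 then 1 else -1"]
          by (simp add: f_def mult.assoc split: if_splits)
      next
        fix w :: complex assume "Re w = 0"
        then show "norm (f w) \<le> R"
          using vertical[OF \<open>0 \<in> A\<close>] by (intro A_D[of "of_real X * w", folded f_def]) simp
      next
        fix w :: complex assume "Re w = 1"
        have "Re (of_nat d ^ n * z) = X"
          by (simp add: X_def flip: of_nat_power)
        then show "norm (f w) \<le> R"
          using vertical[OF scale[OF z(1)], of "of_real X * w" n] \<open>Re w = 1\<close>
          by (intro A_D[of "of_real X * w", folded f_def]) simp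
      qed (use z False in auto)
      then show ?thesis using False by (simp add: f_def X)
    qed
    then show ?thesis by (simp add: A_def)
  qed
  \<comment> \<open>\<open>strip\<close> only shrinks real parts, so for large \<open>t\<close> the
    point \<open>w\<close> is first pushed out to \<open>d ^ m * w\<close>, which is again in
    \<open>A\<close>.\<close>
  obtain m where m: "t < real d ^ m"
    using real_arch_pow[of "real d" t] d by auto
  have "w \<in> A" using w by (simp add: A_def iter)
  have "of_real t * w \<in> A"
  proof (rule strip[OF scale[OF \<open>w \<in> A\<close>, of m], of _ "t / real d ^ m"])
    show "Re (of_real t * w) = t / real d ^ m * Re (of_nat d ^ m * w)"
      using d by (simp flip: of_nat_power)
  qed (use m t d in auto)
  then show ?thesis by (simp add: A_def iter)
qed

section \<open>Periodicity of the Poincare function in the power coordinate\<close>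

text \<open>The branch of \<open>(\<zeta> / c)\<^sup>\<kappa>\<close> on the slit plane, inverse to \<open>z \<mapsto> c z\<^bsup>1/\<kappa>\<^esup>\<close> near the ray
  through \<open>c\<close>.\<close>
definition powr_branch :: "complex \<Rightarrow> real \<Rightarrow> complex \<Rightarrow> complex" where
  "powr_branch c \<kappa> \<zeta> = exp (of_real \<kappa> * (Ln \<zeta> - Ln c))"

lemma powr_branch_nonzero [simp]: "powr_branch c \<kappa> \<zeta> \<noteq> 0"
  by (simp add: powr_branch_def)

lemma powr_branch_scale:
  assumes "a > 0" "\<zeta> \<noteq> 0"
  shows "powr_branch c \<kappa> (of_real a * \<zeta>) = of_real (a powr \<kappa>) * powr_branch c \<kappa> \<zeta>"
  using assms
  by (simp add: powr_branch_def Ln_times_of_real Ln_of_real powr_def distrib_left right_diff_distrib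
      exp_add exp_diff flip: exp_of_real)

lemma norm_powr_branch:
  assumes "\<zeta> \<noteq> 0" "c \<noteq> 0"
  shows "norm (powr_branch c \<kappa> \<zeta>) = (norm \<zeta> / norm c) powr \<kappa>"
  using assms by (simp add: powr_branch_def powr_def ln_div)

lemma holomorphic_on_powr_branch:
  assumes "S \<inter> \<real>\<^sub>\<le>\<^sub>0 = {}"
  shows "powr_branch c \<kappa> holomorphic_on S"
  unfolding powr_branch_def[abs_def] using assms by (intro holomorphic_intros) auto

text \<open>The bound on the angle keeps the imaginary part of the exponent inside the principal
  strip, so that \<open>Ln\<close> undoes the exponential.\<close>

lemma powr_branch_inverse:
  assumes "\<zeta> \<noteq> 0" "c \<noteq> 0" "\<kappa> > 0" and A: "\<bar>\<kappa> * (Arg \<zeta> - Arg c)\<bar> < pi"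
  shows "Arg (powr_branch c \<kappa> \<zeta>) = \<kappa> * (Arg \<zeta> - Arg c)"
    and "c * powr_branch c \<kappa> \<zeta> powr of_real (1 / \<kappa>) = \<zeta>"
proof -
  have "Im (of_real \<kappa> * (Ln \<zeta> - Ln c)) = \<kappa> * (Arg \<zeta> - Arg c)"
    using assms by (simp add: Arg_eq_Im_Ln)
  then have Ln: "Ln (powr_branch c \<kappa> \<zeta>) = of_real \<kappa> * (Ln \<zeta> - Ln c)"
    using A unfolding powr_branch_def by (intro Ln_exp) auto
  then show "Arg (powr_branch c \<kappa> \<zeta>) = \<kappa> * (Arg \<zeta> - Arg c)"
    using assms by (simp add: Arg_eq_Im_Ln)
  show "c * powr_branch c \<kappa> \<zeta> powr of_real (1 / \<kappa>) = \<zeta>"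
    using assms by (simp add: powr_def Ln exp_diff)
qed

text \<open>At time \<open>n\<close> the main exponents of the two orbits differ by
  \<open>d ^ n\<close> times \<open>2 * pi * \<i>\<close>, so the main terms are equal, while the
  errors decay like \<open>(1 / lam) ^ n\<close>. \<open>orbits_eq_if_asymptotic\<close> then gives
  equality on a nonempty open set \<open>G\<close>, and analytic continuation spreads it over the
  half-plane.\<close>

lemma poincare_function_periodic:
  fixes p :: "complex poly" and \<Phi> :: "complex \<Rightarrow> complex"
  assumes deg: "degree p \<ge> 2" and lam: "lam > 1" and hol: "\<Phi> holomorphic_on UNIV"
    and eq: "\<And>z. \<Phi> (of_real lam * z) = poly p (\<Phi> z)"
    and kap: "\<kappa> > 0" "real (degree p) powr \<kappa> = lam"
    and C: "C \<noteq> 0" and c: "Re c > 0" and \<theta>: "\<theta> > 0"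
    and asym: "\<And>z. \<lbrakk>norm z > \<rho>; \<bar>Arg z\<bar> < \<theta>\<rbrakk> \<Longrightarrow>
       \<exists>\<eta>. norm \<eta> \<le> 1 / norm z \<and> \<Phi> z = C * exp (c * z powr of_real (1 / \<kappa>) + \<eta>)"
    and \<zeta>: "Re \<zeta> > 0"
  shows "\<Phi> (powr_branch c \<kappa> (\<zeta> + 2 * of_real pi * \<i>)) = \<Phi> (powr_branch c \<kappa> \<zeta>)"
proof -
  define T where "T = powr_branch c \<kappa>"
  define d where "d = degree p"
  \<comment> \<open>The cap 1 keeps the angle below \<open>pi\<close>, as
    \<open>powr_branch_inverse\<close> requires.\<close>
  define \<theta>' where "\<theta>' = min \<theta> 1"
  have "\<theta>' > 0" using \<theta> by (simp add: \<theta>'_def)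
  have "\<theta>' < pi" using pi_gt3 by (simp add: \<theta>'_def)
  have "c \<noteq> 0" using c by auto
  have d: "d \<ge> 2" using deg by (simp add: d_def)
  obtain r where r: "r > 0"
    "\<And>x y \<eta>. \<lbrakk>\<And>n. x (Suc n) = poly p (x n); \<And>n. y (Suc n) = poly p (y n);
       \<And>n. norm (y n) > 1 / r; \<And>n. x n = y n * exp (\<eta> n); \<And>n. norm (\<eta> n) < r; \<eta> \<longlonglongrightarrow> 0\<rbrakk>
       \<Longrightarrow> x 0 = y (0::nat)"
    using orbits_eq_if_asymptotic[OF deg] by blast
  \<comment> \<open>Beyond \<open>Y\<close> the error of the expansion is at most 1 and below
    \<open>r / 2\<close>, so two errors differ by less than \<open>r\<close>. \<open>X\<close> is
    such that \<open>Re z > X\<close> forces \<open>norm (T z) > Y\<close> and keeps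
    \<open>norm (C * exp z)\<close> above \<open>1 / r\<close> even after a loss of 1 in the
    exponent.\<close>
  define Y where "Y = max \<rho> (max 1 (2 / r))"
  define X where "X = max (norm c * Y powr (1 / \<kappa>)) (max 0 (1 + ln (1 / (r * norm C))))"
  define H where "H = {z. Re z > 0}"
  define Q where "Q = {z \<in> H. X < Re z \<and> \<kappa> * \<bar>Arg z - Arg c\<bar> < \<theta>'}"
  define G where "G = Q \<inter> (\<lambda>z. z + 2 * of_real pi * \<i>) -` Q"
  have "open H" by (simp add: H_def open_halfspace_Re_gt)
  have "connected H" by (simp add: H_def convex_halfspace_Re_gt convex_connected)
  have H_slit: "z \<notin> \<real>\<^sub>\<le>\<^sub>0" if "z \<in> H" for z
    using that by (auto simp: H_def complex_nonpos_Reals_iff)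
  have Arg_cont: "continuous_on H Arg"
    using continuous_on_Arg by (rule continuous_on_subset) (use H_slit in blast)
  have "open {z \<in> H. \<kappa> * \<bar>Arg z - Arg c\<bar> - \<theta>' \<in> {..<0} \<and> X - Re z \<in> {..<0}}"
  proof -
    have "open (H \<inter> (\<lambda>z. \<kappa> * \<bar>Arg z - Arg c\<bar> - \<theta>') -` {..<0})"
      using H_slit by (intro continuous_open_preimage continuous_intros Arg_cont \<open>open H\<close>) auto
    moreover have "open (H \<inter> (\<lambda>z. X - Re z) -` {..<0})"
      by (intro continuous_open_preimage continuous_intros \<open>open H\<close>)
    ultimately have "open ((H \<inter> (\<lambda>z. \<kappa> * \<bar>Arg z - Arg c\<bar> - \<theta>') -` {..<0}) \<inter> (H \<inter> (\<lambda>z. X - Re z) -` {..<0}))"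
      by (rule open_Int)
    also have "\<dots> = {z \<in> H. \<kappa> * \<bar>Arg z - Arg c\<bar> - \<theta>' \<in> {..<0} \<and> X - Re z \<in> {..<0}}" by auto
    finally show ?thesis .
  qed
  also have "{z \<in> H. \<kappa> * \<bar>Arg z - Arg c\<bar> - \<theta>' \<in> {..<0} \<and> X - Re z \<in> {..<0}} = Q"
    by (auto simp: Q_def)
  finally have "open Q" .
  then have "open G"
    unfolding G_def by (intro open_Int open_vimage continuous_intros)
  \<comment> \<open>Far out on the ray through \<open>c\<close>, the shift by
    \<open>2 * pi * \<i>\<close> changes the argument arbitrarily little, so both points lie in
    \<open>Q\<close>.\<close>
  have "G \<noteq> {}"
  proof -
    have "((\<lambda>s. c + of_real (1 / s) * (2 * of_real pi * \<i>)) \<longlongrightarrow> c + of_real 0 * (2 * of_real pi * \<i>)) at_top"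
      by (intro tendsto_intros) real_asymp
    then have "((\<lambda>s. c + of_real (1 / s) * (2 * of_real pi * \<i>)) \<longlongrightarrow> c) at_top" by simp
    moreover have "isCont Arg c"
      using c by (intro continuous_at_Arg H_slit) (simp add: H_def)
    ultimately have "((\<lambda>s. Arg (c + of_real (1 / s) * (2 * of_real pi * \<i>))) \<longlongrightarrow> Arg c) at_top"
      using isCont_tendsto_compose by blast
    then have "((\<lambda>s. \<kappa> * \<bar>Arg (c + of_real (1 / s) * (2 * of_real pi * \<i>)) - Arg c\<bar>) \<longlongrightarrow> \<kappa> * \<bar>Arg c - Arg c\<bar>) at_top"
      by (intro tendsto_mult tendsto_rabs tendsto_diff tendsto_const)
    then have "\<forall>\<^sub>F s in at_top. \<kappa> * \<bar>Arg (c + of_real (1 / s) * (2 * of_real pi * \<i>)) - Arg c\<bar> < \<theta>'"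
      by (rule order_tendstoD) (use \<open>\<theta>' > 0\<close> in simp)
    moreover have "\<forall>\<^sub>F s in at_top. s > max 0 (X / Re c)" by (rule eventually_gt_at_top)
    ultimately have "\<forall>\<^sub>F s in at_top. of_real s * c \<in> G"
    proof eventually_elim
      case (elim s)
      then have s: "s > 0" and "X < s * Re c"
        using c by (auto simp: field_simps)
      have "of_real s * c + 2 * of_real pi * \<i> = of_real s * (c + of_real (1 / s) * (2 * of_real pi * \<i>))"
        using s by (simp add: field_simps)
      then have "Arg (of_real s * c + 2 * of_real pi * \<i>) = Arg (c + of_real (1 / s) * (2 * of_real pi * \<i>))"
        using s by (simp only: Arg_times_of_real)
      moreover have "Arg (of_real s * c) = Arg c" using s by (simp only: Arg_times_of_real)
      ultimately show ?case
        using elim s c \<open>X < s * Re c\<close> \<open>\<theta>' > 0\<close> by (simp add: G_def Q_def H_def)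
    qed
    then show ?thesis
      using eventually_happens'[OF trivial_limit_at_top_linorder] by blast
  qed
  have T_big: "norm (T z) > Y" if "Re z > X" for z
  proof -
    have "Y \<ge> 1" by (simp add: Y_def)
    have "z \<noteq> 0" using that by (auto simp: X_def)
    have "norm c * Y powr (1 / \<kappa>) < norm z"
      using that complex_Re_le_cmod[of z] by (auto simp: X_def)
    then have "Y powr (1 / \<kappa>) < norm z / norm c"
      using \<open>c \<noteq> 0\<close> by (simp add: field_simps)
    then have "(Y powr (1 / \<kappa>)) powr \<kappa> < (norm z / norm c) powr \<kappa>"
      using kap by (intro powr_less_mono2) auto
    then show ?thesis
      using \<open>Y \<ge> 1\<close> kap by (simp add: powr_powr T_def norm_powr_branch \<open>z \<noteq> 0\<close> \<open>c \<noteq> 0\<close>)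
  qed
  have T_scale: "T (of_nat d ^ n * z) = of_real lam ^ n * T z" if "z \<noteq> 0" for n z
  proof -
    have "T (of_real (real d ^ n) * z) = of_real ((real d ^ n) powr \<kappa>) * T z"
      unfolding T_def using d that by (intro powr_branch_scale) auto
    moreover have "(real d ^ n) powr \<kappa> = (real d powr \<kappa>) powr real n"
      using d by (simp add: powr_powr mult.commute flip: powr_realpow)
    moreover have "\<dots> = lam ^ n"
      using kap lam by (simp add: d_def powr_realpow)
    ultimately show ?thesis by simp
  qed
  \<comment> \<open>\<open>T\<close> turns multiplication by \<open>d ^ n\<close> into
    multiplication by \<open>lam ^ n\<close>. Hence the expansion at \<open>T (d ^ n * z)\<close>
    has main exponent exactly \<open>d ^ n * z\<close> and a geometrically decaying error.\<close>
  have expo: "\<exists>\<eta>. norm \<eta> \<le> 1 / norm (T z) * (1 / lam) ^ n \<and>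
      \<Phi> (of_real lam ^ n * T z) = C * exp (of_nat d ^ n * z + \<eta>)" if "z \<in> Q" for z n
  proof -
    have "z \<noteq> 0" using that by (auto simp: Q_def H_def)
    define z' where "z' = of_real (real d ^ n) * z"
    have dn: "real d ^ n > 0" using d by simp
    have "z' \<noteq> 0" using \<open>z \<noteq> 0\<close> dn by (simp add: z'_def)
    have Tz': "T z' = of_real lam ^ n * T z" using T_scale[OF \<open>z \<noteq> 0\<close>] by (simp add: z'_def)
    have "Arg z' = Arg z" unfolding z'_def using dn by (simp only: Arg_times_of_real)
    then have A: "\<bar>\<kappa> * (Arg z' - Arg c)\<bar> < \<theta>'"
      using that kap by (simp add: Q_def abs_mult)
    then have A': "\<bar>\<kappa> * (Arg z' - Arg c)\<bar> < pi" using \<open>\<theta>' < pi\<close> by linarith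
    note inv = powr_branch_inverse[OF \<open>z' \<noteq> 0\<close> \<open>c \<noteq> 0\<close> kap(1) A', folded T_def]
    have nT: "norm (T z') = lam ^ n * norm (T z)"
      using lam by (simp add: Tz' norm_mult norm_power)
    have "1 * norm (T z) \<le> lam ^ n * norm (T z)"
      using lam by (intro mult_right_mono) auto
    moreover have "norm (T z) > \<rho>" using T_big[of z] that by (simp add: Q_def Y_def)
    ultimately have "norm (T z') > \<rho>" using nT by linarith
    moreover have "\<bar>Arg (T z')\<bar> < \<theta>" using A unfolding inv(1) by (simp add: \<theta>'_def)
    ultimately obtain \<eta> where "norm \<eta> \<le> 1 / norm (T z')" "\<Phi> (T z') = C * exp (z' + \<eta>)"
      using asym[of "T z'"] unfolding inv(2) by blast
    moreover have "z' = of_nat d ^ n * z" by (simp add: z'_def)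
    ultimately show ?thesis
      unfolding nT unfolding Tz' by (intro exI[of _ \<eta>]) (simp add: power_one_over field_simps)
  qed
  have G_eq: "\<Phi> (T (z + 2 * of_real pi * \<i>)) = \<Phi> (T z)" if "z \<in> G" for z
  proof -
    define z' where "z' = z + 2 * of_real pi * \<i>"
    have z: "z \<in> Q" "z' \<in> Q" using that by (auto simp: G_def z'_def)
    obtain \<eta> where \<eta>: "\<And>n. norm (\<eta> n) \<le> 1 / norm (T z) * (1 / lam) ^ n"
      "\<And>n. \<Phi> (of_real lam ^ n * T z) = C * exp (of_nat d ^ n * z + \<eta> n)"
      using expo[OF z(1)] by metis
    obtain \<eta>' where \<eta>': "\<And>n. norm (\<eta>' n) \<le> 1 / norm (T z') * (1 / lam) ^ n"
      "\<And>n. \<Phi> (of_real lam ^ n * T z') = C * exp (of_nat d ^ n * z' + \<eta>' n)"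
      using expo[OF z(2)] by metis
    have TY: "norm (T z) > Y" "norm (T z') > Y" using z T_big by (auto simp: Q_def)
    have lamn: "(1 / lam) ^ n \<le> 1" for n using lam by (intro power_le_one) auto
    have bound: "norm w \<le> 1 / t" "norm w < r / 2" "norm w \<le> 1"
      if "norm w \<le> 1 / t * (1 / lam) ^ n" "t > Y" for w :: complex and t n
    proof -
      have t: "t > 1" "t > 2 / r" using that by (auto simp: Y_def)
      have "1 / t * (1 / lam) ^ n \<le> 1 / t * 1"
        using t lamn by (intro mult_left_mono) auto
      with that show *: "norm w \<le> 1 / t" by linarith
      have "1 / t < r / 2" using t r by (simp add: field_simps)
      with * show "norm w < r / 2" by linarith
      have "1 / t \<le> 1" using t by simp
      with * show "norm w \<le> 1" by linarith
    qed
    have "\<Phi> (of_real lam ^ 0 * T z) = \<Phi> (of_real lam ^ 0 * T z')"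
    proof (rule r(2)[where x = "\<lambda>n. \<Phi> (of_real lam ^ n * T z)" and y = "\<lambda>n. \<Phi> (of_real lam ^ n * T z')"
          and \<eta> = "\<lambda>n. \<eta> n - \<eta>' n"])
      fix n
      show "\<Phi> (of_real lam ^ Suc n * T z) = poly p (\<Phi> (of_real lam ^ n * T z))"
        by (simp add: mult.assoc flip: eq)
      show "\<Phi> (of_real lam ^ Suc n * T z') = poly p (\<Phi> (of_real lam ^ n * T z'))"
        by (simp add: mult.assoc flip: eq)
      show "norm (\<eta> n - \<eta>' n) < r"
        using bound(2)[OF \<eta>(1) TY(1), of n] bound(2)[OF \<eta>'(1) TY(2), of n]
          norm_triangle_ineq4[of "\<eta> n" "\<eta>' n"] by linarith
      have "exp (of_nat (d ^ n) * (2 * of_real pi * \<i>)) = 1"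
        by (subst exp_of_nat_mult) (simp add: exp_two_pi_i)
      then have per: "exp (of_nat d ^ n * z') = exp (of_nat d ^ n * z)"
        by (simp add: z'_def distrib_left exp_add)
      show "\<Phi> (of_real lam ^ n * T z) = \<Phi> (of_real lam ^ n * T z') * exp (\<eta> n - \<eta>' n)"
        unfolding \<eta>(2) \<eta>'(2) by (simp add: exp_add exp_diff per)
      have "Re z' > X" "X \<ge> 0" using z by (auto simp: Q_def X_def)
      have "1 * Re z' \<le> real d ^ n * Re z'"
        using d \<open>Re z' > X\<close> \<open>X \<ge> 0\<close> by (intro mult_right_mono) auto
      moreover have "Re (of_nat d ^ n * z') = real d ^ n * Re z'"
        by (simp flip: of_nat_power)
      moreover have "\<bar>Re (\<eta>' n)\<bar> \<le> 1"
        using bound(3)[OF \<eta>'(1) TY(2), of n] abs_Re_le_cmod[of "\<eta>' n"] by linarith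
      moreover have "X \<ge> 1 + ln (1 / (r * norm C))" by (simp add: X_def)
      ultimately have "ln (1 / (r * norm C)) < Re (of_nat d ^ n * z' + \<eta>' n)"
        using \<open>Re z' > X\<close> unfolding plus_complex.sel by linarith
      then have "exp (ln (1 / (r * norm C))) < exp (Re (of_nat d ^ n * z' + \<eta>' n))"
        by simp
      also have "exp (ln (1 / (r * norm C))) = 1 / (r * norm C)"
        using r C by (intro exp_ln) simp
      finally have "norm C * (1 / (r * norm C)) < norm C * exp (Re (of_nat d ^ n * z' + \<eta>' n))"
        using C by (intro mult_strict_left_mono) auto
      then show "1 / r < norm (\<Phi> (of_real lam ^ n * T z'))"
        using C r unfolding \<eta>'(2) norm_mult norm_exp_eq_Re by simp
    next
      have lims: "(\<lambda>n. 1 / norm (T z) * (1 / lam) ^ n) \<longlonglongrightarrow> 0" "(\<lambda>n. 1 / norm (T z') * (1 / lam) ^ n) \<longlonglongrightarrow> 0"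
        using lam by (intro tendsto_mult_right_zero LIMSEQ_power_zero; simp)+
      have "\<eta> \<longlonglongrightarrow> 0"
        by (rule Lim_null_comparison[OF always_eventually lims(1)]) (use \<eta>(1) in blast)
      moreover have "\<eta>' \<longlonglongrightarrow> 0"
        by (rule Lim_null_comparison[OF always_eventually lims(2)]) (use \<eta>'(1) in blast)
      ultimately show "(\<lambda>n. \<eta> n - \<eta>' n) \<longlonglongrightarrow> 0"
        using tendsto_diff by fastforce
    qed
    then show ?thesis by (simp add: z'_def)
  qed
  have T_hol: "(\<lambda>z. \<Phi> (T z)) holomorphic_on H"
    unfolding T_def using H_slit
    by (intro holomorphic_on_compose_gen[OF _ hol, unfolded o_def] holomorphic_on_powr_branch) auto
  have "(\<lambda>z. \<Phi> (T (z + 2 * of_real pi * \<i>))) holomorphic_on H"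
    by (rule holomorphic_on_compose_gen[OF _ T_hol, unfolded o_def])
       (auto simp: H_def intro!: holomorphic_intros)
  from analytic_continuation_open[OF \<open>open G\<close> \<open>open H\<close> \<open>G \<noteq> {}\<close> \<open>connected H\<close> _ this T_hol G_eq]
  have "\<Phi> (T (\<zeta> + 2 * of_real pi * \<i>)) = \<Phi> (T \<zeta>)"
    using \<zeta> by (auto simp: H_def G_def Q_def)
  then show ?thesis by (simp add: T_def)
qed

section \<open>Contradiction from a constant \<open>F\<close>\<close>

theorem theorem2:
  fixes p :: "complex poly" and lam \<beta> :: real and \<Phi> F :: "complex \<Rightarrow> complex"
  assumes real_coeffs: "\<forall>i. coeff p i \<in> \<real>"
    and deg: "degree p \<ge> 2"
    and p0: "poly p 0 = 0"
    and lam: "poly (pderiv p) 0 = complex_of_real lam" "lam > 1"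
    and beta: "\<beta> > 0" "W_sector \<beta> \<subseteq> fatou_inf p"
    and Phi_entire: "\<Phi> holomorphic_on UNIV"
    and Phi_eq: "\<forall>z. \<Phi> (complex_of_real lam * z) = poly p (\<Phi> z)"
    and Phi0: "\<Phi> 0 = 0" "deriv \<Phi> 0 = 1"
    and F_hol: "F holomorphic_on {w. \<bar>Im w\<bar> < \<beta> / ln lam}"
    and F_per: "\<forall>w. \<bar>Im w\<bar> < \<beta> / ln lam \<longrightarrow> F (w + 1) = F w"
    and asym: "\<forall>\<epsilon>>0. \<forall>M>0. \<forall>\<delta>>0. \<exists>R. \<forall>z. R < norm z \<and> \<bar>Arg z\<bar> \<le> \<beta> - \<epsilon> \<longrightarrow>
                 (\<exists>\<eta>. norm \<eta> \<le> \<delta> * norm z powr (- M) \<and>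
                    \<Phi> z = (lead_coeff p) powr (- 1 / (of_nat (degree p) - 1))
                          * exp (z powr complex_of_real (ln (real (degree p)) / ln lam)
                                   * F (Ln z / complex_of_real (ln lam)) + \<eta>))"
    and ray: "\<exists>\<gamma>::real. \<Phi> ` {of_real r * exp (\<i> * of_real \<gamma>) | r. r > 0} \<inter> fatou_inf p \<noteq> {}
                     \<and> \<Phi> ` {of_real r * exp (\<i> * of_real \<gamma>) | r. r > 0} \<inter> julia_set p \<noteq> {}"
  shows "\<not> (\<exists>c. \<forall>w. \<bar>Im w\<bar> < \<beta> / ln lam \<longrightarrow> F w = c)"
proof
  assume "\<exists>c. \<forall>w. \<bar>Im w\<bar> < \<beta> / ln lam \<longrightarrow> F w = c"
  then obtain c where c: "\<And>w. \<bar>Im w\<bar> < \<beta> / ln lam \<Longrightarrow> F w = c" by blast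
  define d where "d = degree p"
  have d: "d \<ge> 2" using deg by (simp add: d_def)
  have ln_lam: "ln lam > 0" and ln_d: "ln (real d) > 0" using lam d by auto
  \<comment> \<open>\<open>\<kappa>\<close> is the reciprocal of the exponent
    \<open>ln d / ln lam\<close> in the expansion; \<open>d powr \<kappa> = lam\<close> matches
    scaling by \<open>d\<close> with scaling by \<open>lam\<close>.\<close>
  define \<kappa> where "\<kappa> = ln lam / ln (real d)"
  have kap: "\<kappa> > 0" using ln_lam ln_d by (simp add: \<kappa>_def)
  have d_kap: "real d powr \<kappa> = lam" using d lam ln_d by (simp add: powr_def \<kappa>_def)
  obtain R where "escape_radius p R"
    using poly_growth_radius[OF deg] by (auto simp: escape_radius_def)
  then interpret escape_radius p R .
  define C where "C = lead_coeff p powr (- 1 / (of_nat (degree p) - 1))"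
  have "C \<noteq> 0" using deg by (auto simp: C_def powr_def)

  obtain r0 where r0: "\<And>z. r0 < norm z \<and> \<bar>Arg z\<bar> \<le> \<beta> - \<beta> / 2 \<Longrightarrow>
      \<exists>\<eta>. norm \<eta> \<le> 1 * norm z powr (- 1) \<and>
        \<Phi> z = C * exp (z powr complex_of_real (ln (real (degree p)) / ln lam)
                        * F (Ln z / complex_of_real (ln lam)) + \<eta>)"
    using asym[rule_format, of "\<beta> / 2" 1 1] beta unfolding C_def by (metis half_gt_zero zero_less_one)
  have expansion: "\<exists>\<eta>. norm \<eta> \<le> 1 / norm z \<and> \<Phi> z = C * exp (c * z powr of_real (1 / \<kappa>) + \<eta>)"
    if z: "norm z > max r0 0" "\<bar>Arg z\<bar> < \<beta> / 2" for z
  proof -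
    have "z \<noteq> 0" using z by auto
    have "Im (Ln z / complex_of_real (ln lam)) = Arg z / ln lam"
      using \<open>z \<noteq> 0\<close> by (simp add: Arg_eq_Im_Ln)
    moreover have "\<bar>Arg z / ln lam\<bar> < \<beta> / ln lam"
      using z beta ln_lam by (simp add: divide_strict_right_mono)
    ultimately have "F (Ln z / complex_of_real (ln lam)) = c" by (intro c) (simp only:)
    moreover have "ln (real (degree p)) / ln lam = 1 / \<kappa>" by (simp add: \<kappa>_def d_def)
    moreover have "norm z powr (- 1) = 1 / norm z" by (simp add: powr_minus_divide)
    ultimately show ?thesis using r0[of z] z by (simp add: mult.commute)
  qed

  have Phi_iter: "(poly p ^^ n) (\<Phi> z) = \<Phi> (of_real lam ^ n * z)" for n z
  proof (induction n)
    case (Suc n)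
    then show ?case using Phi_eq by (simp add: mult.assoc)
  qed simp
  have "(\<Phi> has_field_derivative deriv \<Phi> 0) (at 0)"
    using Phi_entire holomorphic_derivI by blast
  then have Phi_lim: "((\<lambda>z. \<Phi> z / z) \<longlongrightarrow> 1) (at 0)"
    using Phi0 by (simp add: has_field_derivative_iff)

  \<comment> \<open>Small positive \<open>t\<close> have \<open>\<Phi> t\<close> close to
    \<open>t\<close>, hence in the sector, so these values escape. With \<open>Re c \<le> 0\<close>
    the expansion would bound \<open>\<Phi>\<close> by \<open>norm C * exp 1\<close> far out on the
    positive axis, which contains the orbit \<open>\<Phi> (lam ^ n * t)\<close>.\<close>
  have "Re c > 0"
  proof (rule ccontr)
    assume "\<not> Re c > 0"
    have "filterlim (\<lambda>t. complex_of_real t) (at 0) (at_right 0)"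
      by (auto simp: filterlim_at eventually_at_filter intro!: tendsto_eq_intros)
    then have lim: "((\<lambda>t. \<Phi> (of_real t) / of_real t) \<longlongrightarrow> 1) (at_right 0)"
      by (rule filterlim_compose[OF Phi_lim])
    have "isCont Arg 1" by (intro continuous_at_Arg) simp
    then have "((\<lambda>t. Arg (\<Phi> (of_real t) / of_real t)) \<longlongrightarrow> Arg 1) (at_right 0)"
      using lim isCont_tendsto_compose by blast
    then have "((\<lambda>t. \<bar>Arg (\<Phi> (of_real t) / of_real t)\<bar>) \<longlongrightarrow> 0) (at_right 0)"
      using tendsto_rabs_zero by simp
    then have "\<forall>\<^sub>F t in at_right 0. \<bar>Arg (\<Phi> (of_real t) / of_real t)\<bar> < \<beta>"
      by (rule order_tendstoD) (use beta in simp)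
    moreover have "\<forall>\<^sub>F t in at_right 0. \<Phi> (of_real t) / of_real t \<noteq> 0"
      by (rule tendsto_imp_eventually_ne[OF lim]) simp
    moreover have "\<forall>\<^sub>F t::real in at_right 0. t > 0" by (rule eventually_at_right_less)
    ultimately have "\<forall>\<^sub>F t in at_right 0. t > 0 \<and> \<Phi> (of_real t) \<in> W_sector \<beta>"
    proof eventually_elim
      case (elim t)
      then have "Arg (of_real t * (\<Phi> (of_real t) / of_real t)) = Arg (\<Phi> (of_real t) / of_real t)"
        by (simp only: Arg_times_of_real)
      with elim show ?case by (simp add: W_sector_def)
    qed
    then obtain t where t: "t > 0" "\<Phi> (of_real t) \<in> W_sector \<beta>"
      using eventually_happens'[OF trivial_limit_at_right_real] by blast
    then obtain m where m: "norm ((poly p ^^ m) (\<Phi> (of_real t))) > R"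
      using beta fatou_inf_escapes by blast
    have "filterlim (\<lambda>n. lam ^ n * t) at_top sequentially"
      using lam t by real_asymp
    then have "\<forall>\<^sub>F n in sequentially. lam ^ n * t > max r0 1"
      unfolding filterlim_at_top_dense by blast
    moreover have "filterlim (\<lambda>n. 2 ^ (n - m) :: real) at_top sequentially"
      by real_asymp
    then have "\<forall>\<^sub>F n in sequentially. 2 ^ (n - m) > norm C * exp 1"
      unfolding filterlim_at_top_dense by blast
    moreover have "\<forall>\<^sub>F n in sequentially. n \<ge> m" by (rule eventually_ge_at_top)
    ultimately have "\<forall>\<^sub>F n::nat in sequentially. False"
    proof eventually_elim
      case (elim n)
      define x where "x = lam ^ n * t"
      have x: "x > max r0 1" using elim by (simp add: x_def)
      have "norm (complex_of_real x) > max r0 0" "\<bar>Arg (complex_of_real x)\<bar> < \<beta> / 2"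
        using x beta by auto
      then obtain \<eta> where \<eta>: "norm \<eta> \<le> 1 / norm (complex_of_real x)"
        "\<Phi> (of_real x) = C * exp (c * of_real x powr of_real (1 / \<kappa>) + \<eta>)"
        using expansion by blast
      have "norm \<eta> \<le> 1" using \<eta>(1) x by (smt (verit) divide_le_eq_1 norm_of_real)
      then have "Re \<eta> \<le> 1" using complex_Re_le_cmod[of \<eta>] by linarith
      moreover have "complex_of_real x powr of_real (1 / \<kappa>) = of_real (x powr (1 / \<kappa>))"
        using x by (intro powr_of_real) auto
      then have "Re (c * of_real x powr of_real (1 / \<kappa>)) = Re c * x powr (1 / \<kappa>)"
        unfolding \<open>complex_of_real x powr of_real (1 / \<kappa>) = _\<close> by simp
      moreover have "Re c * x powr (1 / \<kappa>) \<le> 0"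
        using \<open>\<not> Re c > 0\<close> by (intro mult_nonpos_nonneg) auto
      ultimately have "exp (Re (c * of_real x powr of_real (1 / \<kappa>) + \<eta>)) \<le> exp 1"
        by simp
      then have "norm (\<Phi> (of_real x)) \<le> norm C * exp 1"
        unfolding \<eta>(2) norm_mult norm_exp_eq_Re by (intro mult_left_mono) auto
      moreover have "norm (\<Phi> (of_real x)) \<ge> 2 ^ (n - m)"
        using iterate_growth_from(1)[OF m, of n] elim by (simp add: Phi_iter x_def)
      ultimately show False using elim by linarith
    qed
    then show False by simp
  qed
  then have "c \<noteq> 0" by auto

  define T where "T = powr_branch c \<kappa>"
  have T_periodic: "\<Phi> (T (z + 2 * of_real pi * \<i>)) = \<Phi> (T z)" if "Re z > 0" for z
    unfolding T_def
    by (rule poincare_function_periodic[where \<rho> = "max r0 0", OF deg lam(2) Phi_entire _ kap _ \<open>C \<noteq> 0\<close> \<open>Re c > 0\<close>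
          half_gt_zero[OF beta(1)] expansion that])
       (use Phi_eq d_kap in \<open>simp_all add: d_def\<close>)

  \<comment> \<open>The lemma is applied to the translate by \<open>2 * pi * \<i>\<close>, which is
    holomorphic around 0 because the unit disc about that point avoids the slit. For
    \<open>s > 0\<close> periodicity identifies it with \<open>\<Phi> (T s)\<close>, which is
    asymptotic to \<open>s powr \<kappa> * T 1\<close> at 0.\<close>
  obtain k :: nat where k: "k > 0" "\<kappa> = real k"
  proof (rule holomorphic_asymptotic_powr_imp_nat)
    show "(\<lambda>z. \<Phi> (T (z + 2 * of_real pi * \<i>))) holomorphic_on ball 0 1"
    proof (rule holomorphic_on_compose_gen[OF _ Phi_entire, unfolded o_def])
      have T_hol: "T holomorphic_on - \<real>\<^sub>\<le>\<^sub>0"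
        unfolding T_def by (rule holomorphic_on_powr_branch) auto
      have "z + 2 * of_real pi * \<i> \<notin> \<real>\<^sub>\<le>\<^sub>0" if "z \<in> ball 0 1" for z
        using that abs_Im_le_cmod[of z] pi_gt3 by (auto simp: complex_nonpos_Reals_iff)
      then show "(\<lambda>z. T (z + 2 * of_real pi * \<i>)) holomorphic_on ball 0 1"
        by (intro holomorphic_on_compose_gen[OF _ T_hol, unfolded o_def] holomorphic_intros) auto
    qed auto
    have T_real: "T (of_real s) = of_real (s powr \<kappa>) * T 1" if "s > 0" for s
      using powr_branch_scale[OF that, of 1] by (simp add: T_def)
    have "((\<lambda>s. s powr \<kappa>) \<longlongrightarrow> 0) (at_right 0)" using kap by real_asymp
    then have "((\<lambda>s. of_real (s powr \<kappa>) * T 1) \<longlongrightarrow> of_real 0 * T 1) (at_right 0)"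
      by (intro tendsto_intros)
    moreover have "\<forall>\<^sub>F s::real in at_right 0. of_real (s powr \<kappa>) * T 1 \<noteq> 0"
      using eventually_at_right_less[of "0::real"] by eventually_elim (simp add: T_def)
    ultimately have "filterlim (\<lambda>s. of_real (s powr \<kappa>) * T 1) (at 0) (at_right 0)"
      by (simp add: filterlim_at)
    then have "((\<lambda>s. \<Phi> (of_real (s powr \<kappa>) * T 1) / (of_real (s powr \<kappa>) * T 1)) \<longlongrightarrow> 1) (at_right 0)"
      by (rule filterlim_compose[OF Phi_lim])
    then have "((\<lambda>s. \<Phi> (of_real (s powr \<kappa>) * T 1) / (of_real (s powr \<kappa>) * T 1) * T 1) \<longlongrightarrow> 1 * T 1) (at_right 0)"
      by (intro tendsto_intros)
    moreover have "\<forall>\<^sub>F s in at_right 0. \<Phi> (of_real (s powr \<kappa>) * T 1) / (of_real (s powr \<kappa>) * T 1) * T 1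
        = \<Phi> (T (of_real s + 2 * of_real pi * \<i>)) / of_real (s powr \<kappa>)"
      using eventually_at_right_less[of "0::real"]
    proof eventually_elim
      case (elim s)
      then have "\<Phi> (T (of_real s + 2 * of_real pi * \<i>)) = \<Phi> (of_real (s powr \<kappa>) * T 1)"
        using T_periodic[of "of_real s"] by (simp add: T_real)
      moreover have "T 1 \<noteq> 0" by (simp add: T_def)
      ultimately show ?case by simp
    qed
    ultimately show "((\<lambda>s. \<Phi> (T (of_real s + 2 * of_real pi * \<i>)) / of_real (s powr \<kappa>)) \<longlongrightarrow> T 1) (at_right 0)"
      by (simp add: tendsto_cong)
  qed (use kap in \<open>auto simp: T_def\<close>)

  \<comment> \<open>With an integer exponent the branch \<open>T\<close> is the monomial
    \<open>b * z ^ k\<close>, where \<open>b\<close> is the inverse of \<open>c ^ k\<close>. This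
    makes the composite with \<open>\<Phi>\<close> entire, so its periodicity extends from the
    half-plane to the whole plane.\<close>
  define b where "b = exp (- of_nat k * Ln c)"
  define \<Theta> where "\<Theta> z = \<Phi> (b * z ^ k)" for z
  have T_power: "T z = b * z ^ k" if "z \<noteq> 0" for z
  proof -
    have "T z = exp (of_nat k * Ln z) * exp (- of_nat k * Ln c)"
      by (simp add: T_def powr_branch_def k right_diff_distrib flip: exp_add)
    also have "exp (of_nat k * Ln z) = z ^ k" using that by (simp add: exp_of_nat_mult)
    finally show ?thesis by (simp add: b_def)
  qed
  have Theta_hol: "\<Theta> holomorphic_on UNIV"
    unfolding \<Theta>_def
    by (intro holomorphic_on_compose_gen[OF _ Phi_entire, unfolded o_def] holomorphic_intros) auto
  have Theta_per: "\<Theta> (z + 2 * of_real pi * \<i>) = \<Theta> z" for z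
  proof (rule analytic_continuation_open[where f = "\<lambda>z. \<Theta> (z + 2 * of_real pi * \<i>)"
        and g = \<Theta> and s = "{z. Re z > 0}" and s' = UNIV])
    show "(\<lambda>z. \<Theta> (z + 2 * of_real pi * \<i>)) holomorphic_on UNIV"
      by (intro holomorphic_on_compose_gen[OF _ Theta_hol, unfolded o_def] holomorphic_intros) auto
    show "{z. Re z > 0} \<noteq> {}" by (auto intro: exI[of _ 1])
    fix z assume "z \<in> {z. Re z > 0}"
    then have "Re z > 0" "z \<noteq> 0" "z + 2 * of_real pi * \<i> \<noteq> 0" by (auto simp: complex_eq_iff)
    then show "\<Theta> (z + 2 * of_real pi * \<i>) = \<Theta> z"
      using T_periodic[of z] by (simp add: T_power \<Theta>_def)
  qed (auto simp: open_halfspace_Re_gt Theta_hol)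
  have "real d ^ k = lam" using d_kap d by (simp add: k powr_realpow)
  then have "of_nat d ^ k = complex_of_real lam" by (metis of_real_of_nat_eq of_real_power)
  then have Theta_semi: "\<Theta> (of_nat d * z) = poly p (\<Theta> z)" for z
    using Phi_eq[rule_format, of "b * z ^ k"] by (simp add: \<Theta>_def power_mult_distrib mult.left_commute)

  obtain \<gamma> r1 r2 where r: "r1 > 0" "r2 > 0" "\<Phi> (of_real r1 * exp (\<i> * of_real \<gamma>)) \<in> fatou_inf p"
    "\<Phi> (of_real r2 * exp (\<i> * of_real \<gamma>)) \<in> julia_set p"
    using ray by blast
  \<comment> \<open>\<open>u\<close> is a \<open>k\<close>-th root adapted to \<open>b\<close>: as
    \<open>b * u ^ k = exp (\<i> * \<gamma>)\<close>, the map \<open>\<Theta>\<close> on the ray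
    through \<open>u\<close> runs through the values of \<open>\<Phi>\<close> on the ray of angle
    \<open>\<gamma>\<close>.\<close>
  define u where "u = exp (\<i> * of_real \<gamma> / of_nat k + Ln c)"
  have "u ^ k = exp (of_nat k * (\<i> * of_real \<gamma> / of_nat k + Ln c))"
    by (simp only: u_def exp_of_nat_mult)
  also have "of_nat k * (\<i> * of_real \<gamma> / of_nat k + Ln c) = \<i> * of_real \<gamma> + of_nat k * Ln c"
    using k by (simp add: field_simps)
  finally have bu: "b * u ^ k = exp (\<i> * of_real \<gamma>)"
    by (simp add: b_def exp_add exp_minus)
  have Theta_ray: "\<Theta> (of_real (s powr (1 / real k)) * u) = \<Phi> (of_real s * exp (\<i> * of_real \<gamma>))" if "s > 0" for s
  proof -
    have "(s powr (1 / real k)) ^ k = s"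
      using that k by (simp add: powr_powr flip: powr_realpow)
    then have "of_real (s powr (1 / real k)) ^ k = complex_of_real s"
      by (metis of_real_power)
    then show ?thesis
      by (simp add: \<Theta>_def power_mult_distrib mult.left_commute[of b] bu)
  qed
  \<comment> \<open>The factor \<open>s1 / s2\<close> leads along the ray from the parameter of the
    Julia point to that of the escaping point.\<close>
  define s1 s2 where "s1 = r1 powr (1 / real k)" and "s2 = r2 powr (1 / real k)"
  have "s1 > 0" "s2 > 0" using r by (auto simp: s1_def s2_def)
  have "norm ((poly p ^^ n) (\<Theta> (of_real (s1 / s2) * (of_real s2 * u)))) \<le> R" for n
  proof (rule periodic_semiconj_bounded_along_ray[OF Theta_hol d Theta_semi Theta_per])
    show "norm (\<Theta> 0) \<le> R" using R_ge_1 k Phi0 by (simp add: \<Theta>_def power_0_left)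
    show "norm ((poly p ^^ n) (\<Theta> (of_real s2 * u))) \<le> R" for n
      using julia_set_bounded_orbit[OF r(4)] r by (simp add: s2_def Theta_ray)
  qed (use \<open>s1 > 0\<close> \<open>s2 > 0\<close> in simp)
  then have "norm ((poly p ^^ n) (\<Theta> (of_real s1 * u))) \<le> R" for n
    using \<open>s2 > 0\<close> by simp
  moreover obtain n where "norm ((poly p ^^ n) (\<Phi> (of_real r1 * exp (\<i> * of_real \<gamma>)))) > R"
    using fatou_inf_escapes[OF r(3)] by blast
  ultimately show False
    using r by (simp add: s1_def Theta_ray not_le[symmetric])
qed

end
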